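(* Let $A$ be a unital associative ring, let $k\ge 1$, and let $n_1,\dots,n_k$ be positive integers. Let $\ell$ be the number of indices $i\in\{1,\dots,k\}$ for which $n_i$ is odd. Put \[ q=\begin{cases}\ell & \text{if } \ell<k \text{ (that is, at least one } n_i \text{ is even)},\\ \ell-1 & \text{if } \ell=k \text{ (that is, all } n_i \text{ are odd)},\end{cases} \] and let $N_{k,q}=n_1+\dots+n_k-2(k-1)+q$. Then, for all $a_{ij}\in A$ ($1\le i\le k$, $1\le j\le n_i$), \[ 3^q\,[a_{11},\dots,a_{1n_1}]\,[a_{21},\dots,a_{2n_2}]\cdots[a_{k1},\dots,a_{kn_k}]\in T^{(N_{k,q})}. \]
   Context: $A$ is a (not necessarily commutative) unital associative ring. Left-normed commutators are defined recursively by $[a_1]=a_1$, $[a_1,a_2]=a_1a_2-a_2a_1$, and $[a_1,\dots,a_{r-1},a_r]=\bigl[[a_1,\dots,a_{r-1}],a_r\bigr]$ for $r>2$. For $r\ge 1$, $T^{(r)}=T^{(r)}(A)$ denotes the two-sided ideal of $A$ generated by all commutators $[a_1,\dots,a_r]$ with $a_i\in A$; in particular $T^{(1)}=A$. *)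

theory Defs
  imports Complex_Main
begin

text \<open>
  The sort \<open>{ring, semiring_numeral}\<close> is that of unital associative rings, the zero ring
  included (\<open>ring_1\<close> would impose \<open>0 \<noteq> 1\<close>).
\<close>

definition commutator :: "'a::ring \<Rightarrow> 'a \<Rightarrow> 'a"
  where "commutator x y = x * y - y * x"

text \<open>The value at the empty list is junk.\<close>

fun left_normed :: "'a::ring list \<Rightarrow> 'a"
  where
    "left_normed [] = 0"
  | "left_normed (x # xs) = foldl commutator x xs"

definition two_sided_ideal :: "'a::ring set \<Rightarrow> bool"
  where "two_sided_ideal I \<longleftrightarrow>
    0 \<in> I \<and> (\<forall>x\<in>I. \<forall>y\<in>I. x - y \<in> I) \<and> (\<forall>x\<in>I. \<forall>a. a * x \<in> I \<and> x * a \<in> I)"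

text \<open>The ideal \<open>T\<^sup>(\<^sup>r\<^sup>)\<close>, meant for \<open>r \<ge> 1\<close>.\<close>

definition commutator_ideal :: "nat \<Rightarrow> 'a::ring set"
  where "commutator_ideal r = two_sided_ideal hull {left_normed as | as. length as = r}"

end

theory Submission
  imports Defs "HOL-Computational_Algebra.Group_Closure"
begin

text \<open>
  Let \<open>L\<^sub>k\<close> be the additive group spanned by the left-normed commutators of length \<open>k\<close>, so that
  \<open>T\<^sup>(\<^sup>k\<^sup>) = A L\<^sub>k\<close>. Everything rests on the exchange relation
  \<open>[u, p] [v, q] + [u, q] [v, p] \<in> T\<^sup>(\<^sup>i\<^sup>+\<^sup>j\<^sup>+\<^sup>1\<^sup>)\<close> for \<open>u \<in> L\<^sub>i\<close>, \<open>v \<in> L\<^sub>j\<close> and arbitrary \<open>p\<close>, \<open>q\<close>, which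
  comes from expanding \<open>[v, p q, u]\<close>.

  For odd \<open>n\<close>, the inclusion \<open>3 L\<^sub>n L\<^sub>m \<subseteq> T\<^sup>(\<^sup>m\<^sup>+\<^sup>n\<^sup>-\<^sup>1\<^sup>)\<close> is proved by induction on \<open>n\<close>. Modulo the products
  with a smaller odd index, a derivation of even length applied to \<open>u v\<close>, \<open>u\<close> of odd index, acts
  on \<open>u\<close> only; applied to the expansion of \<open>[u, x y]\<close> this shows that
  \<open>[x, w\<^sub>1, \<dots>, w\<^sub>n\<^sub>-\<^sub>1] [u, y]\<close> is antisymmetric in \<open>x\<close> and \<open>y\<close>. Together with the exchange
  relation and \<open>[x, w] = - [w, x]\<close> it alternates in \<open>x, w\<^sub>1, w\<^sub>n\<^sub>-\<^sub>1, y\<close>, so for \<open>n = 3\<close> its triple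
  vanishes by the Jacobi identity, while for \<open>n \<ge> 5\<close> the Jacobi identity and the antisymmetry of
  \<open>[[x, w\<^sub>1], [w\<^sub>2, w\<^sub>3]]\<close> kill it altogether, without a further factor \<open>3\<close>.

  For arbitrary \<open>m\<close>, \<open>n\<close> one has \<open>L\<^sub>m L\<^sub>n \<subseteq> T\<^sup>(\<^sup>m\<^sup>+\<^sup>n\<^sup>-\<^sup>2\<^sup>)\<close>: three times the left-hand side is
  contained in the right by the odd case, and so is its double, since up to sign exchange relations
  with \<open>p\<close> a commutator shift entries from one factor to the other.
\<close>

section \<open>Additive subgroups and alternating maps modulo them\<close>

locale additive_subgroup =
  fixes G :: "'a::ab_group_add set"
  assumes zero: "0 \<in> G"
    and diff: "x \<in> G \<Longrightarrow> y \<in> G \<Longrightarrow> x - y \<in> G"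
begin

lemma minus: "x \<in> G \<Longrightarrow> - x \<in> G"
  using diff[OF zero] by simp

lemma add: "x \<in> G \<Longrightarrow> y \<in> G \<Longrightarrow> x + y \<in> G"
  using diff[OF _ minus, of x y] by simp

lemma add_cancel: "x + y \<in> G \<Longrightarrow> x \<in> G \<Longrightarrow> y \<in> G"
  using diff[of "x + y" x] by simp

text \<open>Conjugating (3 4) by (1 4) gives the sign under (1 3). With (1 2) this makes
  \<open>t\<close> invariant modulo \<open>G\<close> under cyclic shifts of its first three
  arguments, so the Jacobi sum is congruent to three times \<open>t\<close>.\<close>

lemma triple_mem_if_alternating_Jacobi:
  fixes t :: "'b \<Rightarrow> 'b \<Rightarrow> 'b \<Rightarrow> 'b \<Rightarrow> 'a"
  assumes t14: "\<And>x w q y. t x w q y + t y w q x \<in> G"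
    and t34: "\<And>x w q y. t x w q y + t x w y q \<in> G"
    and t12: "\<And>x w q y. t x w q y + t w x q y \<in> G"
    and Jacobi: "\<And>x w q y. t x w q y + t w q x y + t q x w y \<in> G"
  shows "t x w q y + t x w q y + t x w q y \<in> G"
proof -
  have t13: "t x w q y + t q w x y \<in> G" for x w q y
    using add[OF diff[OF t14[of x w q y] t34[of y w q x]] t14[of y w x q]]
    by simp
  have a: "t x w q y - t w q x y \<in> G"
    using diff[OF t13[of x w q y] t12[of q w x y]] by simp
  have b: "t x w q y - t q x w y \<in> G"
    using diff[OF t12[of x w q y] t13[of w x q y]] by simp
  show ?thesis
    using add[OF add[OF a b] Jacobi[of x w q y]] by (simp add: algebra_simps)
qed

text \<open>
  The signs of \<open>t\<close> under all transpositions of its arguments follow; then \<open>Jacobi\<close> gives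
  \<open>3 t \<in> G\<close>, and \<open>metabelian\<close>, which is the antisymmetry of \<open>[[x, w], [b, c]]\<close>, gives
  \<open>4 t \<in> G\<close>.
\<close>

lemma mem_if_alternating_Jacobi_metabelian:
  fixes t :: "'b \<Rightarrow> 'b \<Rightarrow> 'b \<Rightarrow> 'b \<Rightarrow> 'b \<Rightarrow> 'b \<Rightarrow> 'a"
  assumes t16: "\<And>x w b c q y. t x w b c q y + t y w b c q x \<in> G"
    and t56: "\<And>x w b c q y. t x w b c q y + t x w b c y q \<in> G"
    and t12: "\<And>x w b c q y. t x w b c q y + t w x b c q y \<in> G"
    and Jacobi: "\<And>x w b c q y. t x w b c q y + t w b x c q y + t b x w c q y \<in> G"
    and metabelian: "\<And>x w b c q y.
      t x w b c q y - t x w c b q y + t b c x w q y - t b c w x q y \<in> G"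
  shows "t x w b c q y \<in> G"
proof -
  have t15: "t x w b c q y + t q w b c x y \<in> G" for x w b c q y
    using add[OF diff[OF t16[of x w b c q y] t56[of y w b c q x]] t16[of y w b c x q]]
    by simp
  have t25: "t x w b c q y + t x q b c w y \<in> G" for x w b c q y
    using add[OF diff[OF t12[of x w b c q y] t15[of w x b c q y]] t12[of q x b c w y]]
    by simp
  \<comment> \<open>\<open>Jacobi\<close> is added to its copy with \<open>w\<close> and
    \<open>q\<close> interchanged: two of the resulting pairs lie in \<open>G\<close> by
    \<open>t25\<close> and \<open>t15\<close>, hence so does the third. \<open>t45\<close> treats
    \<open>metabelian\<close> in the same way.\<close>
  have t35: "t b x w c q y + t b x q c w y \<in> G" for x w b c q y
  proof -
    have "(t x w b c q y + t x q b c w y) + (t w b x c q y + t q b x c w y) \<in> G"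
      by (intro add t25 t15)
    moreover have "((t x w b c q y + t x q b c w y) + (t w b x c q y + t q b x c w y))
        + (t b x w c q y + t b x q c w y) \<in> G"
      using add[OF Jacobi[of x w b c q y] Jacobi[of x q b c w y]] by (simp add: algebra_simps)
    ultimately show ?thesis
      by (metis add_cancel)
  qed
  have t45: "t b c x w q y + t b c x q w y \<in> G" for x w b c q y
  proof -
    have "((t x w b c q y + t x q b c w y) - (t x w c b q y + t x q c b w y))
        - (t b c w x q y + t b c q x w y) \<in> G"
      by (intro diff t25 t35)
    moreover have "(((t x w b c q y + t x q b c w y) - (t x w c b q y + t x q c b w y))
        - (t b c w x q y + t b c q x w y)) + (t b c x w q y + t b c x q w y) \<in> G"
      using add[OF metabelian[of x w b c q y] metabelian[of x q b c w y]]
      by (simp add: algebra_simps)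
    ultimately show ?thesis
      by (metis add_cancel)
  qed
  have t34: "t x w b c q y + t x w c b q y \<in> G" for x w b c q y
    using add[OF diff[OF t35[of x w b c q y] t45[of x w q c b y]] t35[of x w q b c y]]
    by simp
  have t23: "t x w b c q y + t x b w c q y \<in> G" for x w b c q y
    using add[OF diff[OF t25[of x w b c q y] t35[of x q b c w y]] t25[of x q w c b y]]
    by simp
  have three: "t x w b c q y + t x w b c q y + t x w b c q y \<in> G"
  proof -
    have a: "t x w b c q y - t w b x c q y \<in> G"
      using diff[OF t12[of x w b c q y] t23[of w x b c q y]] by simp
    have b: "t x w b c q y - t b x w c q y \<in> G"
      using diff[OF t23[of x w b c q y] t12[of x b w c q y]] by simp
    show ?thesis
      using add[OF add[OF a b] Jacobi[of x w b c q y]] by (simp add: algebra_simps)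
  qed
  have even: "t x w b c q y - t b c x w q y \<in> G" for x w b c
  proof -
    have "t x w b c q y - t b x w c q y \<in> G"
      using diff[OF t23[of x w b c q y] t12[of x b w c q y]] by simp
    moreover have "t b x w c q y - t b c x w q y \<in> G"
      using diff[OF t34[of b x w c q y] t23[of b x c w q y]] by simp
    ultimately show ?thesis
      using add by fastforce
  qed
  \<comment> \<open>By \<open>t34\<close>, \<open>metabelian\<close> puts twice the sum of
    \<open>t x w b c q y\<close> and \<open>t b c x w q y\<close> into \<open>G\<close>; swapping
    the two pairs is an even permutation, so these terms are congruent.\<close>
  have "t x w b c q y + t x w b c q y + t x w b c q y + t x w b c q y \<in> G"
    using add[OF add[OF metabelian[of x w b c q y] t34[of x w b c q y]]
        add[OF add[OF even[of x w b c] even[of x w b c]] t34[of b c x w q y]]]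
    by (simp add: algebra_simps)
  from diff[OF this three] show ?thesis
    by simp
qed

end

lemma additive_subgroup_group_closure: "additive_subgroup (group_closure S)"
  by unfold_locales (auto intro: group_closure.diff)

section \<open>Commutator identities\<close>

lemma commutator_add_left: "commutator (x + y) z = commutator x z + commutator y z"
  by (simp add: commutator_def algebra_simps)

lemma commutator_diff_left: "commutator (x - y) z = commutator x z - commutator y z"
  by (simp add: commutator_def algebra_simps)

lemma commutator_diff_right: "commutator x (y - z) = commutator x y - commutator x z"
  by (simp add: commutator_def algebra_simps)

lemma commutator_zero [simp]: "commutator 0 x = 0" "commutator x 0 = 0"
  by (simp_all add: commutator_def)

lemma commutator_mult_left:
  "commutator (x * y) z = x * commutator y z + commutator x z * y"
  by (simp add: commutator_def algebra_simps)

lemma commutator_commutator_right: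
  "commutator x (commutator y z) = commutator (commutator x y) z - commutator (commutator x z) y"
  by (simp add: commutator_def algebra_simps)

lemma foldl_commutator_zero [simp]: "foldl commutator 0 ws = 0"
  by (induction ws) simp_all

lemma foldl_commutator_add:
  "foldl commutator (x + y) ws = foldl commutator x ws + foldl commutator y ws"
  by (induction ws arbitrary: x y) (simp_all add: commutator_add_left)

lemma foldl_commutator_diff:
  "foldl commutator (x - y) ws = foldl commutator x ws - foldl commutator y ws"
  by (induction ws arbitrary: x y) (simp_all add: commutator_diff_left)

section \<open>The lower central series\<close>

text \<open>
  The lower central series of the Lie ring \<open>A\<close>, indexed so that \<open>lcs 1 = A\<close>; by truncated
  subtraction also \<open>lcs 0 = A\<close>.
\<close>

definition lcs :: "nat \<Rightarrow> 'a::ring set"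
  where "lcs k = group_closure {foldl commutator x ws | x ws. length ws = k - 1}"

lemma additive_subgroup_lcs: "additive_subgroup (lcs k)"
  by (simp add: lcs_def additive_subgroup_group_closure)

lemma foldl_commutator_mem_lcs: "length ws = k - 1 \<Longrightarrow> foldl commutator x ws \<in> lcs k"
  unfolding lcs_def by (auto intro: group_closure.base)

lemma lcs_subset:
  fixes G :: "'a::ring set"
  assumes "additive_subgroup G" "\<And>x ws. length ws = k - 1 \<Longrightarrow> foldl commutator x ws \<in> G"
  shows "lcs k \<subseteq> G"
proof
  interpret additive_subgroup G by fact
  fix x :: 'a assume "x \<in> lcs k"
  then show "x \<in> G"
    unfolding lcs_def
    by (induction rule: group_closure.induct) (use assms(2) zero diff in auto)
qed

lemma mem_lcs_trivial: "k \<le> 1 \<Longrightarrow> x \<in> lcs k"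
  using foldl_commutator_mem_lcs[of "[]" k x] by simp

text \<open>Splits off the last entry of a generator. The bound on \<open>k\<close> excludes
  \<open>lcs 1\<close>, which is the whole ring and not a span of commutators.\<close>

lemma lcs_Suc_subset:
  fixes G :: "'a::ring set"
  assumes "additive_subgroup G" "\<And>x y. x \<in> lcs k \<Longrightarrow> commutator x y \<in> G" "k \<ge> 1"
  shows "lcs (Suc k) \<subseteq> G"
proof (rule lcs_subset[OF assms(1)])
  fix x :: 'a and ws :: "'a list" assume "length ws = Suc k - 1"
  with assms(3) obtain us y where "ws = us @ [y]" "length us = k - 1"
    by (cases ws rule: rev_cases) auto
  then show "foldl commutator x ws \<in> G"
    using assms(2) foldl_commutator_mem_lcs[of us k x] by simp
qed

lemma commutator_mem_lcs_Suc:
  fixes x y :: "'a::ring"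
  assumes "x \<in> lcs k"
  shows "commutator x y \<in> lcs (Suc k)"
proof -
  interpret additive_subgroup "lcs (Suc k) :: 'a set" by (rule additive_subgroup_lcs)
  have "lcs k \<subseteq> {x. commutator x y \<in> lcs (Suc k)}"
  proof (rule lcs_subset)
    show "additive_subgroup {x. commutator x y \<in> lcs (Suc k)}"
      by unfold_locales (auto simp: zero commutator_diff_left diff)
    fix x :: 'a and ws :: "'a list" assume "length ws = k - 1"
    then have "commutator (foldl commutator x ws) y \<in> lcs (Suc k)"
      using foldl_commutator_mem_lcs[of "ws @ [y]" "Suc k" x]
      by (cases k) (auto intro: mem_lcs_trivial)
    then show "foldl commutator x ws \<in> {x. commutator x y \<in> lcs (Suc k)}"
      by simp
  qed
  with assms show ?thesis by auto
qed

lemma foldl_commutator_mem_lcs_add: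
  "x \<in> lcs k \<Longrightarrow> foldl commutator x ws \<in> lcs (k + length ws)"
  by (induction ws arbitrary: x k) (use commutator_mem_lcs_Suc in fastforce)+

text \<open>The leading entries of a long commutator are absorbed into its first entry.\<close>

lemma lcs_antimono:
  assumes "j \<le> k"
  shows "lcs k \<subseteq> (lcs j :: 'a::ring set)"
proof (rule lcs_subset[OF additive_subgroup_lcs])
  fix x :: 'a and ws :: "'a list" assume "length ws = k - 1"
  then have "length (drop (k - 1 - (j - 1)) ws) = j - 1"
    using assms by auto
  then have "foldl commutator (foldl commutator x (take (k - 1 - (j - 1)) ws))
      (drop (k - 1 - (j - 1)) ws) \<in> lcs j"
    by (rule foldl_commutator_mem_lcs)
  then show "foldl commutator x ws \<in> lcs j"
    by (simp flip: foldl_append)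
qed

text \<open>Induction on the length of the right argument by the Jacobi identity, which replaces
  \<open>x\<close> by \<open>commutator x w\<close>; hence \<open>x\<close> and \<open>i\<close>
  vary in \<open>aux\<close>.\<close>

lemma commutator_mem_lcs_add:
  fixes x y :: "'a::ring"
  assumes "x \<in> lcs i" "y \<in> lcs j"
  shows "commutator x y \<in> lcs (i + j)"
proof -
  interpret additive_subgroup "lcs k :: 'a set" for k by (rule additive_subgroup_lcs)
  have aux: "commutator x (foldl commutator y ws) \<in> lcs (i + Suc (length ws))"
    if "x \<in> lcs i" for x y :: 'a and i ws
    using that
  proof (induction ws arbitrary: x i rule: rev_induct)
    case Nil
    then show ?case by (simp add: commutator_mem_lcs_Suc)
  next
    case (snoc w ws)
    have "commutator (commutator x (foldl commutator y ws)) w \<in> lcs (i + Suc (length (ws @ [w])))"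
      using commutator_mem_lcs_Suc[OF snoc.IH[OF snoc.prems]] by simp
    moreover have "commutator (commutator x w) (foldl commutator y ws)
        \<in> lcs (i + Suc (length (ws @ [w])))"
      using snoc.IH[OF commutator_mem_lcs_Suc[OF snoc.prems]] by simp
    ultimately show ?case
      using diff by (simp add: commutator_commutator_right)
  qed
  have "lcs j \<subseteq> {y. commutator x y \<in> lcs (i + j)}"
  proof (rule lcs_subset)
    show "additive_subgroup {y. commutator x y \<in> lcs (i + j)}"
      by unfold_locales (auto simp: zero commutator_diff_right diff)
    fix y :: 'a and ws :: "'a list" assume "length ws = j - 1"
    then have "i + j \<le> i + Suc (length ws)" by simp
    then show "foldl commutator y ws \<in> {y. commutator x y \<in> lcs (i + j)}"
      using aux[OF assms(1), of y ws] lcs_antimono by blast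
  qed
  with assms(2) show ?thesis by auto
qed

section \<open>Ideals spanned by multiples of the lower central series\<close>

text \<open>Generated by left multiples, so that inclusions can be checked on products
  \<open>a * x\<close>; closure on the right is \<open>lcs_ideal_mult_right\<close>.\<close>

definition lcs_ideal :: "nat \<Rightarrow> 'a::ring set"
  where "lcs_ideal k = group_closure {a * x | a x. x \<in> lcs k}"

lemma additive_subgroup_lcs_ideal: "additive_subgroup (lcs_ideal k)"
  by (simp add: lcs_ideal_def additive_subgroup_group_closure)

interpretation lcs_ideal: additive_subgroup "lcs_ideal k" for k
  by (rule additive_subgroup_lcs_ideal)

lemma mult_mem_lcs_ideal: "x \<in> lcs k \<Longrightarrow> a * x \<in> lcs_ideal k"
  unfolding lcs_ideal_def by (auto intro: group_closure.base)

lemma lcs_ideal_subset: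
  fixes G :: "'a::ring set"
  assumes "additive_subgroup G" "\<And>a x. x \<in> lcs k \<Longrightarrow> a * x \<in> G"
  shows "lcs_ideal k \<subseteq> G"
proof
  interpret additive_subgroup G by fact
  fix x :: 'a assume "x \<in> lcs_ideal k"
  then show "x \<in> G"
    unfolding lcs_ideal_def
    by (induction rule: group_closure.induct) (use assms(2) zero diff in auto)
qed

lemma lcs_ideal_antimono: "j \<le> k \<Longrightarrow> lcs_ideal k \<subseteq> lcs_ideal j"
  using lcs_antimono
  by (intro lcs_ideal_subset additive_subgroup_lcs_ideal mult_mem_lcs_ideal) blast

lemma lcs_subset_lcs_ideal: "lcs k \<subseteq> (lcs_ideal k :: 'a::{ring, monoid_mult} set)"
  using mult_mem_lcs_ideal[of _ k "1 :: 'a"] by auto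

lemma lcs_ideal_mult_left:
  assumes "x \<in> lcs_ideal k"
  shows "a * x \<in> lcs_ideal k"
proof -
  have "lcs_ideal k \<subseteq> {x. a * x \<in> lcs_ideal k}"
  proof (rule lcs_ideal_subset)
    show "additive_subgroup {x. a * x \<in> lcs_ideal k}"
      by unfold_locales (auto simp: lcs_ideal.zero right_diff_distrib lcs_ideal.diff)
    show "b * x \<in> {x. a * x \<in> lcs_ideal k}" if "x \<in> lcs k" for b x
      using mult_mem_lcs_ideal[OF that, of "a * b"] by (simp add: mult.assoc)
  qed
  with assms show ?thesis by auto
qed

text \<open>Moving \<open>a\<close> to the left of \<open>x\<close> costs
  \<open>commutator x a\<close>, which again lies in \<open>lcs k\<close>.\<close>

lemma lcs_ideal_mult_right:
  assumes "x \<in> lcs_ideal k"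
  shows "x * a \<in> lcs_ideal k"
proof -
  have "lcs_ideal k \<subseteq> {x. x * a \<in> lcs_ideal k}"
  proof (rule lcs_ideal_subset)
    show "additive_subgroup {x. x * a \<in> lcs_ideal k}"
      by unfold_locales (auto simp: lcs_ideal.zero left_diff_distrib lcs_ideal.diff)
    show "b * x \<in> {x. x * a \<in> lcs_ideal k}" if "x \<in> lcs k" for b x
    proof -
      have "commutator x a \<in> lcs k"
        using commutator_mem_lcs_Suc[OF that] lcs_antimono[of k "Suc k"] by auto
      then have "(b * a) * x + b * commutator x a \<in> lcs_ideal k"
        by (intro lcs_ideal.add mult_mem_lcs_ideal that)
      then show ?thesis
        by (simp add: commutator_def algebra_simps)
    qed
  qed
  with assms show ?thesis by auto
qed

section \<open>Swapping factors and the exchange relation\<close>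

lemma swap_mem_lcs_ideal:
  fixes x y :: "'a::{ring, monoid_mult}"
  assumes "x \<in> lcs i" "y \<in> lcs j"
  shows "x * y - y * x \<in> lcs_ideal (i + j)"
  using commutator_mem_lcs_add[OF assms] lcs_subset_lcs_ideal by (auto simp: commutator_def)

text \<open>The decomposition is the Leibniz expansion of \<open>[v, p q, u]\<close>.\<close>

lemma exchange_decomposition:
  assumes "u \<in> lcs i" "v \<in> lcs j"
  shows "\<exists>l1 l2 l3. l1 \<in> lcs (i + j + 1) \<and> l2 \<in> lcs (i + j + 1) \<and> l3 \<in> lcs (i + j + 1) \<and>
    commutator u p * commutator v q + commutator u q * commutator v p = p * l1 + q * l2 + l3"
proof -
  interpret additive_subgroup "lcs k" for k by (rule additive_subgroup_lcs)
  define l where "l y = commutator (commutator v y) u" for y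
  have l: "l y \<in> lcs (i + j + 1)" for y
    using commutator_mem_lcs_add[OF commutator_mem_lcs_Suc[OF assms(2)] assms(1)]
    by (simp add: l_def add.commute)
  \<comment> \<open>This commutator and \<open>commutator (l p) q\<close> below are the costs of
    reordering factors in the Leibniz expansion; both have index one higher than required.\<close>
  have "commutator (commutator v p) (commutator u q) \<in> lcs (i + j + 2)"
    using commutator_mem_lcs_add[OF commutator_mem_lcs_Suc[OF assms(2)]
        commutator_mem_lcs_Suc[OF assms(1)]]
    by (simp add: add.commute)
  moreover have "commutator (l p) q \<in> lcs (i + j + 2)"
    using commutator_mem_lcs_Suc[OF l] by simp
  ultimately have "commutator (l p) q - l (p * q) - commutator (commutator v p) (commutator u q)
      \<in> lcs (i + j + 1)"
    using diff[OF diff[OF _ l]] lcs_antimono[of "i + j + 1" "i + j + 2"] by auto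
  moreover have "commutator u p * commutator v q + commutator u q * commutator v p
      = p * l q + q * l p
        + (commutator (l p) q - l (p * q) - commutator (commutator v p) (commutator u q))"
    by (simp add: l_def commutator_def algebra_simps)
  ultimately show ?thesis
    using l by blast
qed

text \<open>The form modulo the ideal. The explicit coefficients of
  \<open>exchange_decomposition\<close> are kept for \<open>foldl_commutator_mult_mem\<close>, which
  differentiates \<open>p * l1\<close> and \<open>q * l2\<close> further.\<close>

lemma exchange:
  fixes u v p q :: "'a::{ring, monoid_mult}"
  assumes "u \<in> lcs i" "v \<in> lcs j"
  shows "commutator u p * commutator v q + commutator u q * commutator v p
    \<in> lcs_ideal (i + j + 1)"
proof -
  obtain l1 l2 l3 where l: "l1 \<in> lcs (i + j + 1)" "l2 \<in> lcs (i + j + 1)" "l3 \<in> lcs (i + j + 1)"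
    and eq: "commutator u p * commutator v q + commutator u q * commutator v p
      = p * l1 + q * l2 + l3"
    using exchange_decomposition[OF assms] by blast
  show ?thesis
    unfolding eq using l lcs_subset_lcs_ideal[of "i + j + 1"]
    by (intro lcs_ideal.add mult_mem_lcs_ideal) auto
qed


section \<open>Induction step for factors of odd index\<close>

text \<open>\<open>odd_mult_mem\<close> is the induction hypothesis. \<open>G\<close> is abstract
  because \<open>n = 3\<close> uses \<open>lcs_ideal\<close> and \<open>n \<ge> 5\<close> uses
  \<open>lcs_ideal3\<close>, so that the factor 3 enters only once.\<close>

locale odd_products =
  fixes G :: "nat \<Rightarrow> 'a::{ring, monoid_mult} set" and n :: nat
  assumes subgroup: "additive_subgroup (G m)"
    and lcs_ideal_subset_G: "lcs_ideal m \<subseteq> G m"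
    and odd_mult_mem: "odd j \<Longrightarrow> j < n \<Longrightarrow> u \<in> lcs j \<Longrightarrow> v \<in> lcs k \<Longrightarrow> u * v \<in> G (j + k - 1)"
begin

sublocale additive_subgroup "G m" for m
  by (rule subgroup)

lemma lcs_subset_G: "lcs m \<subseteq> G m"
  using lcs_subset_lcs_ideal lcs_ideal_subset_G by blast

text \<open>Derivations are applied in pairs to keep indices odd. In the Leibniz expansion the mixed
  terms become \<open>p * l1 + q * l2 + l3\<close>; these and the term with both derivations on
  \<open>v\<close> are negligible by \<open>small\<close>.\<close>

lemma foldl_commutator_mult_mem:
  assumes "even (length ws)" "odd i" "i + length ws \<le> n" "u \<in> lcs i" "v \<in> lcs k"
  shows "foldl commutator (u * v) ws - foldl commutator u ws * v \<in> G (i + k + length ws - 1)"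
  using assms
proof (induction ws arbitrary: u v i k rule: induct_list012)
  case 1
  then show ?case by (simp add: zero)
next
  case (2 x)
  then show ?case by simp
next
  case (3 p q ws)
  let ?m = "i + k + length (p # q # ws) - 1"
  have m: "?m = i + k + length ws + 1"
    by simp
  \<comment> \<open>By the induction hypothesis \<open>ws\<close> acts on \<open>x\<close> only,
    modulo \<open>G ?m\<close>; the index of the result is odd and below \<open>n\<close>, so
    \<open>odd_mult_mem\<close> applies.\<close>
  have small: "foldl commutator (x * y) ws \<in> G ?m"
    if "odd i'" "i' \<le> i" "x \<in> lcs i'" "y \<in> lcs k'" "i' + k' = i + k + 2" for x y i' k'
  proof -
    have "foldl commutator x ws * y \<in> G (i' + length ws + k' - 1)"
      using that "3.prems"
      by (intro odd_mult_mem foldl_commutator_mem_lcs_add) auto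
    moreover have "foldl commutator (x * y) ws - foldl commutator x ws * y
        \<in> G (i' + k' + length ws - 1)"
      using that "3.prems" by (intro "3.IH"(1)) auto
    moreover have "i' + length ws + k' - 1 = ?m" "i' + k' + length ws - 1 = ?m"
      using that(5) by auto
    ultimately show ?thesis
      using add by fastforce
  qed
  have i: "i \<ge> 1"
    using "3.prems"(2) by (cases i) auto
  obtain l1 l2 l3 where l: "l1 \<in> lcs (i + k + 1)" "l2 \<in> lcs (i + k + 1)" "l3 \<in> lcs (i + k + 1)"
    and eq: "commutator u p * commutator v q + commutator u q * commutator v p
      = p * l1 + q * l2 + l3"
    using exchange_decomposition[OF "3.prems"(4,5)] by blast
  have u: "commutator (commutator u p) q \<in> lcs (i + 2)"
    using commutator_mem_lcs_Suc[OF commutator_mem_lcs_Suc[OF "3.prems"(4)]] by simp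
  have v: "commutator (commutator v p) q \<in> lcs (k + 2)"
    using commutator_mem_lcs_Suc[OF commutator_mem_lcs_Suc[OF "3.prems"(5)]] by simp
  have "commutator (commutator (u * v) p) q
      = commutator (commutator u p) q * v + (p * l1 + q * l2 + l3)
        + u * commutator (commutator v p) q"
    unfolding eq[symmetric]
    by (simp add: commutator_mult_left commutator_add_left algebra_simps)
  then have expand: "foldl commutator (u * v) (p # q # ws) - foldl commutator u (p # q # ws) * v
      = (foldl commutator (commutator (commutator u p) q * v) ws
          - foldl commutator (commutator (commutator u p) q) ws * v)
        + (foldl commutator (p * l1) ws + foldl commutator (q * l2) ws + foldl commutator l3 ws)
        + foldl commutator (u * commutator (commutator v p) q) ws"
    by (simp add: foldl_commutator_add)
  show ?case
    unfolding expand
  proof (intro add)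
    have "foldl commutator (commutator (commutator u p) q * v) ws
        - foldl commutator (commutator (commutator u p) q) ws * v
        \<in> G (i + 2 + k + length ws - 1)"
      using "3.prems" u by (intro "3.IH"(1)) auto
    moreover have "i + 2 + k + length ws - 1 = ?m"
      by simp
    ultimately show "foldl commutator (commutator (commutator u p) q * v) ws
        - foldl commutator (commutator (commutator u p) q) ws * v \<in> G ?m"
      by simp
    show "foldl commutator (p * l1) ws \<in> G ?m" "foldl commutator (q * l2) ws \<in> G ?m"
      using l i by (intro small[where i' = 1 and k' = "i + k + 1"]; simp add: mem_lcs_trivial)+
    show "foldl commutator l3 ws \<in> G ?m"
      using foldl_commutator_mem_lcs_add[OF l(3), of ws] lcs_subset_G by (auto simp: add_ac)
    show "foldl commutator (u * commutator (commutator v p) q) ws \<in> G ?m"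
      using "3.prems" v by (intro small[where i' = i and k' = "k + 2"]) auto
  qed
qed

text \<open>Apply \<open>ws\<close> to the expansion of \<open>commutator u (x * y)\<close>: on the
  products it acts only on the left factors \<open>x\<close> and \<open>y\<close>, and the remaining
  terms are Lie elements of sufficient index.\<close>

lemma exchange_first:
  assumes "even (length ws)" "length ws < n" "u \<in> lcs i"
  shows "foldl commutator x ws * commutator u y + foldl commutator y ws * commutator u x
    \<in> G (i + length ws + 1)"
proof -
  let ?m = "i + length ws + 1"
  have diff_mem: "foldl commutator (x * commutator u y) ws - foldl commutator x ws * commutator u y
      \<in> G ?m" for x y
    using foldl_commutator_mult_mem[of ws 1 x "commutator u y" "Suc i"] assms
      commutator_mem_lcs_Suc[OF assms(3), of y] mem_lcs_trivial[of 1 x]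
    by (simp add: add_ac)
  have lie: "foldl commutator (commutator u z) ws \<in> lcs ?m" for z
    using foldl_commutator_mem_lcs_add[OF commutator_mem_lcs_Suc[OF assms(3)], of z ws] by simp
  have "foldl commutator (commutator (commutator u x) y) ws \<in> lcs (Suc ?m)"
    using foldl_commutator_mem_lcs_add[OF commutator_mem_lcs_Suc[OF commutator_mem_lcs_Suc[OF assms(3)]],
        of x y ws] by simp
  then have lie': "foldl commutator (commutator (commutator u x) y) ws \<in> lcs ?m"
    using lcs_antimono[of ?m "Suc ?m"] by auto
  have "commutator u (x * y)
      = x * commutator u y + y * commutator u x + commutator (commutator u x) y"
    by (simp add: commutator_def algebra_simps)
  then have "foldl commutator (x * commutator u y) ws + foldl commutator (y * commutator u x) ws
      = foldl commutator (commutator u (x * y)) ws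
        - foldl commutator (commutator (commutator u x) y) ws"
    by (simp add: foldl_commutator_add)
  also have "\<dots> \<in> G ?m"
    using lie lie' lcs_subset_G by (intro diff) auto
  finally have "foldl commutator (x * commutator u y) ws + foldl commutator (y * commutator u x) ws
      \<in> G ?m" .
  from diff[OF this add[OF diff_mem[of x y] diff_mem[of y x]]] show ?thesis
    by (simp add: algebra_simps)
qed

lemma exchange_last:
  assumes "u \<in> lcs i"
  shows "foldl commutator x (ws @ [q]) * commutator u y
    + foldl commutator x (ws @ [y]) * commutator u q \<in> G (i + length ws + 2)"
  using exchange[OF foldl_commutator_mem_lcs[of ws "Suc (length ws)" x] assms, of q y]
    lcs_ideal_subset_G[of "i + length ws + 2"]
  by (auto simp: add_ac)

lemma triple_mult_mem:
  assumes "n = 3" "u \<in> lcs i"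
  shows "foldl commutator x [w, q] * commutator u y + foldl commutator x [w, q] * commutator u y
    + foldl commutator x [w, q] * commutator u y \<in> G (i + 3)"
proof (rule triple_mem_if_alternating_Jacobi
    [where t = "\<lambda>x w q y. foldl commutator x [w, q] * commutator u y"])
  fix x w q y
  show "foldl commutator x [w, q] * commutator u y + foldl commutator y [w, q] * commutator u x
      \<in> G (i + 3)"
    using exchange_first[of "[w, q]" u i x y] assms by (simp add: numeral_3_eq_3)
  show "foldl commutator x [w, q] * commutator u y + foldl commutator x [w, y] * commutator u q
      \<in> G (i + 3)"
    using exchange_last[OF assms(2), of x "[w]" q y] by (simp add: numeral_3_eq_3)
  have "foldl commutator x [w, q] * commutator u y + foldl commutator w [x, q] * commutator u y = 0"
    by (simp add: commutator_def algebra_simps)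
  then show "foldl commutator x [w, q] * commutator u y + foldl commutator w [x, q] * commutator u y
      \<in> G (i + 3)"
    using zero by simp
  have "foldl commutator x [w, q] * commutator u y + foldl commutator w [q, x] * commutator u y
      + foldl commutator q [x, w] * commutator u y = 0"
    by (simp add: commutator_def algebra_simps)
  then show "foldl commutator x [w, q] * commutator u y + foldl commutator w [q, x] * commutator u y
      + foldl commutator q [x, w] * commutator u y \<in> G (i + 3)"
    using zero by simp
qed

text \<open>Length at least 5 leaves four entries \<open>x\<close>, \<open>w\<close>,
  \<open>b\<close>, \<open>c\<close> before the exchangeable last entry \<open>q\<close>. The
  identities that involve only these four already hold for the commutator \<open>z\<close> of length
  4.\<close>

lemma mult_mem:
  assumes "even (length ws)" "n = length ws + 5" "u \<in> lcs i"
  shows "foldl commutator x ([w, b, c] @ ws @ [q]) * commutator u y \<in> G (i + n)"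
proof (rule mem_if_alternating_Jacobi_metabelian
    [where t = "\<lambda>x w b c q y. foldl commutator x ([w, b, c] @ ws @ [q]) * commutator u y"])
  fix x w b c q y
  define z where "z x w b c = commutator (commutator (commutator x w) b) c" for x w b c :: 'a
  have z: "foldl commutator x ([w, b, c] @ ws @ [q]) = commutator (foldl commutator (z x w b c) ws) q"
    for x w b c q
    by (simp add: z_def)
  have n: "i + n = i + length ([w, b, c] @ ws @ [q]) + 1" "i + n = i + length ([w, b, c] @ ws) + 2"
    using assms(2) by simp_all
  show "foldl commutator x ([w, b, c] @ ws @ [q]) * commutator u y
      + foldl commutator y ([w, b, c] @ ws @ [q]) * commutator u x \<in> G (i + n)"
    unfolding n(1)
    using assms by (intro exchange_first) auto
  show "foldl commutator x ([w, b, c] @ ws @ [q]) * commutator u y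
      + foldl commutator x ([w, b, c] @ ws @ [y]) * commutator u q \<in> G (i + n)"
    unfolding n(2) using exchange_last[OF assms(3), of x "[w, b, c] @ ws" q y] by simp
  have "z x w b c + z w x b c = 0"
    by (simp add: z_def commutator_def algebra_simps)
  then have "foldl commutator x ([w, b, c] @ ws @ [q]) * commutator u y
      + foldl commutator w ([x, b, c] @ ws @ [q]) * commutator u y = 0"
    unfolding z
    by (simp flip: distrib_right commutator_add_left foldl_commutator_add)
  then show "foldl commutator x ([w, b, c] @ ws @ [q]) * commutator u y
      + foldl commutator w ([x, b, c] @ ws @ [q]) * commutator u y \<in> G (i + n)"
    using zero by simp
  have "z x w b c + z w b x c + z b x w c = 0"
    by (simp add: z_def commutator_def algebra_simps)
  then have "foldl commutator x ([w, b, c] @ ws @ [q]) * commutator u y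
      + foldl commutator w ([b, x, c] @ ws @ [q]) * commutator u y
      + foldl commutator b ([x, w, c] @ ws @ [q]) * commutator u y = 0"
    unfolding z
    by (simp flip: distrib_right commutator_add_left foldl_commutator_add)
  then show "foldl commutator x ([w, b, c] @ ws @ [q]) * commutator u y
      + foldl commutator w ([b, x, c] @ ws @ [q]) * commutator u y
      + foldl commutator b ([x, w, c] @ ws @ [q]) * commutator u y \<in> G (i + n)"
    using zero by simp
  have "z x w b c - z x w c b + z b c x w - z b c w x = 0"
    by (simp add: z_def commutator_def algebra_simps)
  then have "foldl commutator x ([w, b, c] @ ws @ [q]) * commutator u y
      - foldl commutator x ([w, c, b] @ ws @ [q]) * commutator u y
      + foldl commutator b ([c, x, w] @ ws @ [q]) * commutator u y
      - foldl commutator b ([c, w, x] @ ws @ [q]) * commutator u y = 0"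
    unfolding z
    by (simp flip: distrib_right commutator_add_left foldl_commutator_add
        left_diff_distrib commutator_diff_left foldl_commutator_diff)
  then show "foldl commutator x ([w, b, c] @ ws @ [q]) * commutator u y
      - foldl commutator x ([w, c, b] @ ws @ [q]) * commutator u y
      + foldl commutator b ([c, x, w] @ ws @ [q]) * commutator u y
      - foldl commutator b ([c, w, x] @ ws @ [q]) * commutator u y \<in> G (i + n)"
    using zero by simp
qed

end

section \<open>Products with a factor of odd index\<close>

lemma three_mult: "3 * x = x + x + (x :: 'a::{ring, semiring_numeral})"
proof -
  have "3 * x = (1 + 1 + 1) * x"
    by (simp only: one_add_one[symmetric] numeral_Bit1 numeral_One)
  then show ?thesis
    by (simp only: distrib_right mult_1_left)
qed

text \<open>Encodes the factor 3 in a subgroup, so that it is not multiplied up along the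
  induction.\<close>

definition lcs_ideal3 :: "nat \<Rightarrow> 'a::{ring, semiring_numeral} set"
  where "lcs_ideal3 k = {x. 3 * x \<in> lcs_ideal k}"

lemma additive_subgroup_lcs_ideal3: "additive_subgroup (lcs_ideal3 k)"
  by unfold_locales
    (auto simp: lcs_ideal3_def right_diff_distrib lcs_ideal.zero intro: lcs_ideal.diff)

interpretation lcs_ideal3: additive_subgroup "lcs_ideal3 k" for k
  by (rule additive_subgroup_lcs_ideal3)

lemma lcs_ideal_subset_lcs_ideal3: "lcs_ideal k \<subseteq> lcs_ideal3 k"
  by (auto simp: lcs_ideal3_def intro: lcs_ideal_mult_left)

lemma lcs_ideal3_mult_left:
  assumes "x \<in> lcs_ideal3 k"
  shows "a * x \<in> lcs_ideal3 k"
proof -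
  have "3 * (a * x) = a * (3 * x)"
    by (simp add: three_mult distrib_left)
  then show ?thesis
    using assms by (simp add: lcs_ideal3_def lcs_ideal_mult_left)
qed

lemma additive_subgroup_mult_vimage:
  fixes G :: "'a::ring set"
  assumes "additive_subgroup G"
  shows "additive_subgroup {x. a * x \<in> G}" "additive_subgroup {x. x * a \<in> G}"
proof -
  interpret additive_subgroup G by fact
  show "additive_subgroup {x. a * x \<in> G}"
    by unfold_locales (auto simp: zero right_diff_distrib diff)
  show "additive_subgroup {x. x * a \<in> G}"
    by unfold_locales (auto simp: zero left_diff_distrib diff)
qed

theorem odd_lcs_mult_lcs:
  fixes v c :: "'a::{ring, semiring_numeral}"
  assumes "odd n" "v \<in> lcs n" "c \<in> lcs m"
  shows "v * c \<in> lcs_ideal3 (n + m - 1)"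
  using assms
proof (induction n arbitrary: v c m rule: less_induct)
  case (less n)
  have IH: "u * v \<in> lcs_ideal3 (j + k - 1)" if "odd j" "j < n" "u \<in> lcs j" "v \<in> lcs k"
    for j k and u v :: 'a
    using less.IH that by blast
  have generators: "foldl commutator x ws * commutator u y \<in> lcs_ideal3 (n + i)"
    if u: "u \<in> lcs i" and len: "length ws = n - 1" for x u y :: 'a and ws i
  proof -
    have "n = 1 \<or> n = 3 \<or> n \<ge> 5"
      using less.prems(1) by presburger
    then consider "n = 1" | "n = 3" | "n \<ge> 5" by blast
    then show ?thesis
    proof cases
      case 1
      then have "x * commutator u y \<in> lcs_ideal (n + i)"
        using commutator_mem_lcs_Suc[OF u] by (simp add: mult_mem_lcs_ideal)
      then show ?thesis
        using 1 len lcs_ideal_subset_lcs_ideal3 by auto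
    next
      case 2
      \<comment> \<open>The only odd index below 3 is 1, where no factor 3 arises.\<close>
      interpret odd_products "lcs_ideal :: nat \<Rightarrow> 'a set" n
      proof unfold_locales
        show "u * v \<in> lcs_ideal (j + k - 1)" if "odd j" "j < n" "u \<in> lcs j" "v \<in> lcs k"
          for j k and u v :: 'a
        proof -
          have "j = 1"
            using that(1,2) 2 by presburger
          then show ?thesis
            using mult_mem_lcs_ideal[OF that(4)] by simp
        qed
      qed (auto intro: lcs_ideal.zero lcs_ideal.diff)
      obtain w q where "ws = [w, q]"
        using len 2 by (auto simp: length_Suc_conv numeral_2_eq_2)
      then show ?thesis
        using triple_mult_mem[OF 2 u, of x w q y] 2
        by (simp add: lcs_ideal3_def three_mult add.commute)
    next
      case 3
      interpret odd_products "lcs_ideal3 :: nat \<Rightarrow> 'a set" n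
        using IH by unfold_locales
          (auto intro: lcs_ideal3.zero lcs_ideal3.diff dest: subsetD[OF lcs_ideal_subset_lcs_ideal3])
      have "length ws = Suc (Suc (Suc (Suc (n - 5))))"
        using len 3 by simp
      then obtain w b c zs where zs: "ws = w # b # c # zs" "length zs = Suc (n - 5)"
        by (auto simp: length_Suc_conv)
      then obtain us q where "zs = us @ [q]" "length us = n - 5"
        by (cases zs rule: rev_cases) auto
      then have ws: "ws = [w, b, c] @ us @ [q]" and "even (length us)" "n = length us + 5"
        using zs 3 less.prems(1) by auto
      then show ?thesis
        unfolding ws add.commute[of n] using mult_mem u by blast
    qed
  qed
  have "lcs n \<subseteq> {v. v * c \<in> lcs_ideal3 (n + m - 1)}"
  \<comment> \<open>For \<open>m \<le> 1\<close> the element \<open>c\<close> is arbitrary and need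
    not be a sum of commutators, so \<open>generators\<close> does not apply.\<close>
  proof (cases "m \<le> 1")
    case True
    then have "lcs_ideal n \<subseteq> lcs_ideal (n + m - 1)"
      by (intro lcs_ideal_antimono) simp
    then show ?thesis
      using lcs_subset_lcs_ideal[of n] lcs_ideal_mult_right[of _ n c] lcs_ideal_subset_lcs_ideal3
      by blast
  next
    case False
    show ?thesis
    proof (intro lcs_subset additive_subgroup_mult_vimage additive_subgroup_lcs_ideal3)
      fix x :: 'a and ws :: "'a list" assume len: "length ws = n - 1"
      obtain i where i: "m = Suc i" "i \<ge> 1"
        using False by (cases m) auto
      have "lcs (Suc i) \<subseteq> {c. foldl commutator x ws * c \<in> lcs_ideal3 (n + m - 1)}"
        using i generators[OF _ len]
        by (intro lcs_Suc_subset additive_subgroup_mult_vimage additive_subgroup_lcs_ideal3) auto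
      then show "foldl commutator x ws \<in> {v. v * c \<in> lcs_ideal3 (n + m - 1)}"
        using less.prems(3) i by auto
    qed
  qed
  with less.prems(2) show ?case by auto
qed

text \<open>If only \<open>n\<close> is odd, the factors are swapped at the cost of a commutator of
  index \<open>m + n\<close>.\<close>

theorem lcs_ideal_mult_lcs_odd:
  fixes x c :: "'a::{ring, semiring_numeral}"
  assumes "odd m \<or> odd n" "x \<in> lcs_ideal m" "c \<in> lcs n"
  shows "3 * (x * c) \<in> lcs_ideal (m + n - 1)"
proof -
  have "l * c \<in> lcs_ideal3 (m + n - 1)" if l: "l \<in> lcs m" for l
  proof (cases "odd m")
    case True
    then show ?thesis
      using odd_lcs_mult_lcs l assms(3) by blast
  next
    case False
    then have "c * l \<in> lcs_ideal3 (m + n - 1)"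
      using odd_lcs_mult_lcs[OF _ assms(3) l] assms(1) by (simp add: add.commute)
    moreover have "l * c - c * l \<in> lcs_ideal3 (m + n - 1)"
      using swap_mem_lcs_ideal[OF l assms(3)] lcs_ideal_antimono[of "m + n - 1" "m + n"]
        lcs_ideal_subset_lcs_ideal3 by fastforce
    ultimately show ?thesis
      using lcs_ideal3.add by fastforce
  qed
  then have "lcs_ideal m \<subseteq> {x. x * c \<in> lcs_ideal3 (m + n - 1)}"
    by (intro lcs_ideal_subset additive_subgroup_mult_vimage additive_subgroup_lcs_ideal3)
      (auto simp: mult.assoc lcs_ideal3_mult_left)
  with assms(2) show ?thesis
    by (auto simp: lcs_ideal3_def)
qed

section \<open>Products of factors of arbitrary index\<close>

text \<open>Exchanging the entries \<open>commutator s q\<close> and \<open>y\<close> shows that a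
  cyclic shift of \<open>s\<close>, \<open>q\<close>, \<open>y\<close> changes the sign of
  \<open>e\<close> modulo the ideal. Three shifts return to \<open>e\<close> with sign -1.\<close>

lemma double_exchange:
  fixes u v s q y :: "'a::{ring, monoid_mult}"
  assumes "u \<in> lcs i" "v \<in> lcs j"
  defines "e \<equiv> commutator (commutator u s) q * commutator v y
    + commutator u y * commutator (commutator v s) q"
  shows "e + e \<in> lcs_ideal (i + j + 1)"
proof -
  define \<phi> where "\<phi> s q y = commutator (commutator u s) q * commutator v y
    + commutator u y * commutator (commutator v s) q" for s q y
  have us: "commutator u s \<in> lcs (Suc i)" and vs: "commutator v s \<in> lcs (Suc j)" for s
    using assms commutator_mem_lcs_Suc by blast+
  have \<alpha>: "commutator (commutator u s) q * commutator v y
      + commutator (commutator u s) y * commutator v q \<in> lcs_ideal (i + j + 1)" for s q y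
    using exchange[OF us assms(2)] lcs_ideal_antimono[of "i + j + 1" "Suc i + j + 1"] by auto
  have \<beta>: "commutator u y * commutator (commutator v s) q
      + commutator u q * commutator (commutator v s) y \<in> lcs_ideal (i + j + 1)" for s q y
    using exchange[OF assms(1) vs] lcs_ideal_antimono[of "i + j + 1" "i + Suc j + 1"] by auto
  have \<phi>: "\<phi> s q y + \<phi> q y s \<in> lcs_ideal (i + j + 1)" for s q y
  proof -
    have "\<phi> s q y + \<phi> q y s
        = (commutator u (commutator s q) * commutator v y
            + commutator u y * commutator v (commutator s q))
          + (commutator (commutator u q) s * commutator v y
            + commutator (commutator u q) y * commutator v s)
          + (commutator u y * commutator (commutator v q) s
            + commutator u s * commutator (commutator v q) y)"
      by (simp add: \<phi>_def commutator_commutator_right algebra_simps)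
    also have "\<dots> \<in> lcs_ideal (i + j + 1)"
      by (intro lcs_ideal.add exchange assms \<alpha> \<beta>)
    finally show ?thesis .
  qed
  from lcs_ideal.add[OF lcs_ideal.diff[OF \<phi>[of s q y] \<phi>[of q y s]] \<phi>[of y s q]]
  show ?thesis
    by (simp add: \<phi>_def e_def)
qed

text \<open>\<open>double_exchange\<close> shortens the left factor by one entry and lengthens the
  right one, keeping \<open>m + n\<close>. For a left index at most 2 or a right index at most 1,
  the loss of 2 makes the claim immediate.\<close>

lemma double_lcs_mult_lcs:
  fixes c v :: "'a::{ring, monoid_mult}"
  assumes "c \<in> lcs m" "v \<in> lcs n"
  shows "c * v + c * v \<in> lcs_ideal (m + n - 2)"
  using assms
proof (induction m arbitrary: c v n)
  case 0
  then show ?case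
    using mult_mem_lcs_ideal[of v n c] lcs_ideal_antimono[of "n - 2" n] lcs_ideal.add by auto
next
  case (Suc m)
  consider "m \<le> 1" | "n \<le> 1" | i j where "m = Suc i" "i \<ge> 1" "n = Suc j" "j \<ge> 1"
    by (cases m; cases n) fastforce+
  then show ?case
  proof cases
    case 1
    then have "lcs_ideal n \<subseteq> lcs_ideal (Suc m + n - 2)"
      by (intro lcs_ideal_antimono) simp
    then show ?thesis
      using mult_mem_lcs_ideal[OF Suc.prems(2), of c] lcs_ideal.add by blast
  next
    case 2
    then have "lcs_ideal (Suc m) \<subseteq> lcs_ideal (Suc m + n - 2)"
      by (intro lcs_ideal_antimono) simp
    moreover have "c * v \<in> lcs_ideal (Suc m)"
      using Suc.prems(1) lcs_subset_lcs_ideal lcs_ideal_mult_right by blast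
    ultimately show ?thesis
      using lcs_ideal.add by blast
  next
    case (3 i j)
    let ?I = "lcs_ideal (Suc m + n - 2)"
    have sub: "additive_subgroup {x. x + x \<in> ?I}"
    proof unfold_locales
      show "x - y \<in> {x. x + x \<in> ?I}" if "x \<in> {x. x + x \<in> ?I}" "y \<in> {x. x + x \<in> ?I}" for x y
        using lcs_ideal.diff[of "x + x" _ "y + y"] that by (simp add: algebra_simps)
    qed (simp add: lcs_ideal.zero)
    have step: "commutator (commutator u s) q * commutator w y \<in> {x. x + x \<in> ?I}"
      if "u \<in> lcs i" "w \<in> lcs j" for u s q w y :: 'a
    proof -
      have "commutator u y * commutator (commutator w s) q \<in> {x. x + x \<in> ?I}"
        using Suc.IH[of "commutator u y" "commutator (commutator w s) q" "Suc (Suc j)"] that 3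
          commutator_mem_lcs_Suc[of u i y] commutator_mem_lcs_Suc[of w j s]
          commutator_mem_lcs_Suc[of "commutator w s" "Suc j" q]
        by simp
      moreover have "commutator (commutator u s) q * commutator w y
          + commutator u y * commutator (commutator w s) q \<in> {x. x + x \<in> ?I}"
        using double_exchange[OF that, of s q y] 3 by simp
      ultimately show ?thesis
        using additive_subgroup.diff[OF sub] by fastforce
    qed
    have "lcs (Suc (Suc i)) \<subseteq> {c. c * v \<in> {x. x + x \<in> ?I}}"
    proof (intro lcs_Suc_subset additive_subgroup_mult_vimage sub)
      fix c' q :: 'a assume c': "c' \<in> lcs (Suc i)"
      have "lcs (Suc j) \<subseteq> {v. commutator c' q * v \<in> {x. x + x \<in> ?I}}"
      proof (intro lcs_Suc_subset additive_subgroup_mult_vimage sub)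
        fix w y :: 'a assume w: "w \<in> lcs j"
        have "lcs (Suc i) \<subseteq> {d. commutator d q * commutator w y \<in> {x. x + x \<in> ?I}}"
        proof (intro lcs_Suc_subset)
          show "additive_subgroup {d. commutator d q * commutator w y \<in> {x. x + x \<in> ?I}}"
            using additive_subgroup.zero[OF sub] additive_subgroup.diff[OF sub]
            by unfold_locales
              (simp_all only: mem_Collect_eq commutator_diff_left left_diff_distrib
                commutator_zero mult_zero_left)
        qed (use step w 3 in auto)
        with c' show "commutator w y \<in> {v. commutator c' q * v \<in> {x. x + x \<in> ?I}}"
          by auto
      qed (use 3 in auto)
      with Suc.prems(2) 3 show "commutator c' q \<in> {c. c * v \<in> {x. x + x \<in> ?I}}"
        by auto
    qed simp
    with Suc.prems(1) 3 show ?thesis by auto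
  qed
qed

text \<open>Both the triple and the double of \<open>l * c\<close> lie in the ideal, hence so does
  their difference.\<close>

theorem lcs_ideal_mult_lcs:
  fixes x c :: "'a::{ring, semiring_numeral}"
  assumes "x \<in> lcs_ideal m" "c \<in> lcs n"
  shows "x * c \<in> lcs_ideal (m + n - 2)"
proof -
  have "3 * (l * c) \<in> lcs_ideal (m + n - 2)" if l: "l \<in> lcs m" for l
  proof -
    consider "n = 0" | "odd n" | "even n" "n \<noteq> 0" by blast
    then show ?thesis
    proof cases
      case 1
      then have "lcs_ideal m \<subseteq> lcs_ideal (m + n - 2)"
        by (intro lcs_ideal_antimono) simp
      moreover have "3 * (l * c) \<in> lcs_ideal m"
        using l lcs_subset_lcs_ideal by (intro lcs_ideal_mult_left lcs_ideal_mult_right) auto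
      ultimately show ?thesis by blast
    next
      case 2
      have "3 * (l * c) \<in> lcs_ideal (m + n - 1)"
        using 2 l lcs_subset_lcs_ideal assms(2) by (intro lcs_ideal_mult_lcs_odd) auto
      moreover have "lcs_ideal (m + n - 1) \<subseteq> lcs_ideal (m + n - 2)"
        by (intro lcs_ideal_antimono) simp
      ultimately show ?thesis by blast
    next
      case 3
      then obtain k where k: "n = Suc k" "odd k" "k \<ge> 1"
        by (cases n) (auto elim: oddE)
      let ?I = "lcs_ideal (m + n - 2)"
      have "lcs (Suc k) \<subseteq> {c. 3 * l * c \<in> ?I}"
      proof (intro lcs_Suc_subset additive_subgroup_mult_vimage additive_subgroup_lcs_ideal k)
        \<comment> \<open>Leibniz rewrites \<open>l * commutator w y\<close> as
          \<open>commutator (l * w) y - commutator l y * w\<close>, where \<open>w\<close> has odd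
          index.\<close>
        fix w y :: 'a assume w: "w \<in> lcs k"
        have "3 * (l * w) \<in> ?I"
          using lcs_ideal_mult_lcs_odd[of m k l w] k l w lcs_subset_lcs_ideal by auto
        then have "commutator (3 * (l * w)) y \<in> ?I"
          unfolding commutator_def
          using lcs_ideal.diff lcs_ideal_mult_left lcs_ideal_mult_right by blast
        moreover have "3 * (commutator l y * w) \<in> ?I"
          using lcs_ideal_mult_lcs_odd[of "Suc m" k "commutator l y" w] k w
            commutator_mem_lcs_Suc[OF l, of y] lcs_subset_lcs_ideal
            lcs_ideal_antimono[of "m + n - 2" "m + n - 1"]
          by auto
        moreover have "commutator (3 * (l * w)) y - 3 * (commutator l y * w) = 3 * l * commutator w y"
          by (simp add: three_mult commutator_def algebra_simps)
        ultimately show "commutator w y \<in> {c. 3 * l * c \<in> ?I}"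
          using lcs_ideal.diff by fastforce
      qed
      with assms(2) k show ?thesis
        by (auto simp: mult.assoc)
    qed
  qed
  then have "l * c \<in> lcs_ideal (m + n - 2)" if "l \<in> lcs m" for l
    using lcs_ideal.diff[OF _ double_lcs_mult_lcs[OF that assms(2)], of "3 * (l * c)"] that
    by (simp add: three_mult)
  then have "lcs_ideal m \<subseteq> {x. x * c \<in> lcs_ideal (m + n - 2)}"
    by (intro lcs_ideal_subset additive_subgroup_mult_vimage additive_subgroup_lcs_ideal)
      (auto simp: mult.assoc lcs_ideal_mult_left)
  with assms(1) show ?thesis by auto
qed

section \<open>Passage to the commutator ideals and products of k commutators\<close>

text \<open>At \<open>k = 0\<close> the junk value makes the right side zero while
  \<open>lcs 0\<close> is the whole ring.\<close>

lemma lcs_ideal_subset_commutator_ideal: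
  assumes "k \<ge> 1"
  shows "lcs_ideal k \<subseteq> (commutator_ideal k :: 'a::ring set)"
  unfolding commutator_ideal_def hull_def
proof (rule Inter_greatest)
  fix I :: "'a set"
  assume "I \<in> {I. two_sided_ideal I \<and> {left_normed as | as. length as = k} \<subseteq> I}"
  then have I: "two_sided_ideal I" and gen: "\<And>as. length as = k \<Longrightarrow> left_normed as \<in> I"
    by auto
  interpret additive_subgroup I
    using I by unfold_locales (auto simp: two_sided_ideal_def)
  have "lcs k \<subseteq> I"
  proof (rule lcs_subset)
    fix x :: 'a and ws :: "'a list" assume "length ws = k - 1"
    then show "foldl commutator x ws \<in> I"
      using gen[of "x # ws"] assms by simp
  qed unfold_locales
  then show "lcs_ideal k \<subseteq> I"
    using I by (intro lcs_ideal_subset) (unfold_locales, auto simp: two_sided_ideal_def)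
qed

lemma left_normed_mem_lcs: "length as \<ge> 1 \<Longrightarrow> left_normed as \<in> lcs (length as)"
  by (cases as) (simp_all add: foldl_commutator_mem_lcs)

text \<open>
  The index \<open>N\<close> is even exactly if an even \<open>n i\<close> has occurred. Hence only an even \<open>n i\<close> after the
  first one loses \<open>2\<close> instead of \<open>1\<close> in the index, and it needs no factor \<open>3\<close>.
\<close>

lemma prod_list_mem_lcs_ideal:
  fixes x :: "nat \<Rightarrow> 'a::{ring, semiring_numeral}" and n :: "nat \<Rightarrow> nat"
  defines "l k \<equiv> card {i \<in> {1..k}. odd (n i)}"
  defines "q k \<equiv> if l k < k then l k else l k - 1"
  assumes "k \<ge> 1"
    and "\<And>i. i \<in> {1..k} \<Longrightarrow> n i \<ge> 1"
    and "\<And>i. i \<in> {1..k} \<Longrightarrow> x i \<in> lcs (n i)"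
  shows "\<exists>N \<ge> 1. int N = (\<Sum>i = 1..k. int (n i)) - 2 * (int k - 1) + int (q k) \<and>
    (even N \<longleftrightarrow> l k < k) \<and> 3 ^ q k * (\<Prod>i\<leftarrow>[1..<k + 1]. x i) \<in> lcs_ideal N"
  using assms(3-)
proof (induction k rule: dec_induct)
  case base
  have "l 1 = (if odd (n 1) then 1 else 0)"
    by (auto simp: l_def Collect_conv_if)
  moreover have "x 1 \<in> lcs_ideal (n 1)"
    using base(2) lcs_subset_lcs_ideal by auto
  ultimately show ?case
    using base by (intro exI[of _ "n 1"]) (auto simp: q_def)
next
  case (step k)
  then obtain N where N: "N \<ge> 1" "int N = (\<Sum>i = 1..k. int (n i)) - 2 * (int k - 1) + int (q k)"
    "even N \<longleftrightarrow> l k < k" and mem: "3 ^ q k * (\<Prod>i\<leftarrow>[1..<k + 1]. x i) \<in> lcs_ideal N"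
    by auto
  define P where "P = (\<Prod>i\<leftarrow>[1..<k + 1]. x i)"
  have P: "(\<Prod>i\<leftarrow>[1..<Suc k + 1]. x i) = P * x (Suc k)"
    by (simp add: P_def)
  have pos: "n (Suc k) \<ge> 1" and x: "x (Suc k) \<in> lcs (n (Suc k))"
    using step.prems by auto
  have "l k \<le> card {1..k}"
    unfolding l_def by (intro card_mono) auto
  then have le: "l k \<le> k" by simp
  have "{i \<in> {1..Suc k}. odd (n i)} =
      (if odd (n (Suc k)) then insert (Suc k) {i \<in> {1..k}. odd (n i)} else {i \<in> {1..k}. odd (n i)})"
    by (auto simp: le_Suc_eq)
  then have l: "l (Suc k) = (if odd (n (Suc k)) then Suc (l k) else l k)"
    by (simp add: l_def)
  show ?case
  proof (cases "even N \<and> even (n (Suc k))")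
    case True
    then have "q (Suc k) = q k" "l (Suc k) < Suc k"
      using l le N(3) by (auto simp: q_def)
    \<comment> \<open>Keeps the new index positive and its truncated subtraction exact.\<close>
    moreover have "n (Suc k) \<ge> 2" "N \<ge> 2"
      using True pos N(1) by (auto elim!: evenE)
    moreover have "3 ^ q k * (P * x (Suc k)) \<in> lcs_ideal (N + n (Suc k) - 2)"
      using lcs_ideal_mult_lcs[OF mem x] by (simp add: P_def mult.assoc)
    ultimately show ?thesis
      using True N unfolding P
      by (intro exI[of _ "N + n (Suc k) - 2"]) (auto simp: of_nat_diff)
  next
    case False
    \<comment> \<open>If all \<open>n i\<close> so far are odd, \<open>q k = k - 1\<close> and
      either parity of the next one gives \<open>q (Suc k) = k\<close>; otherwise the next one is
      odd and raises \<open>l\<close>.\<close>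
    then have q: "q (Suc k) = Suc (q k)" and "even (N + n (Suc k) - 1) \<longleftrightarrow> l (Suc k) < Suc k"
      using l le N(1,3) step.hyps(1) by (auto simp: q_def)
    moreover have "3 * (3 ^ q k * P * x (Suc k)) \<in> lcs_ideal (N + n (Suc k) - 1)"
      using lcs_ideal_mult_lcs_odd[OF _ mem x] False by (auto simp: P_def)
    ultimately show ?thesis
      using N pos unfolding P
      by (intro exI[of _ "N + n (Suc k) - 1"]) (auto simp: of_nat_diff mult.assoc)
  qed
qed

theorem corollary1p3:
  fixes a :: "nat \<Rightarrow> nat \<Rightarrow> 'a::{ring, semiring_numeral}"
    and n :: "nat \<Rightarrow> nat"
    and k l q N :: nat
  assumes "k \<ge> 1"
    and "\<And>i. i \<in> {1..k} \<Longrightarrow> n i \<ge> 1"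
    and "l = card {i \<in> {1..k}. odd (n i)}"
    and "q = (if l < k then l else l - 1)"
    and "int N = (\<Sum>i = 1..k. int (n i)) - 2 * (int k - 1) + int q"
  shows "3 ^ q * (\<Prod>i\<leftarrow>[1..<k + 1]. left_normed (map (a i) [1..<n i + 1])) \<in> commutator_ideal N"
proof -
  define x where "x i = left_normed (map (a i) [1..<n i + 1])" for i
  have "x i \<in> lcs (n i)" if "i \<in> {1..k}" for i
    using left_normed_mem_lcs[of "map (a i) [1..<n i + 1]"] assms(2)[OF that] by (simp add: x_def)
  \<comment> \<open>The witness equals \<open>N\<close> and supplies \<open>N \<ge> 1\<close>, which
    the passage to \<open>commutator_ideal N\<close> requires.\<close>
  then have "\<exists>N' \<ge> 1. int N' = int N \<and> (even N' \<longleftrightarrow> l < k)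
      \<and> 3 ^ q * (\<Prod>i\<leftarrow>[1..<k + 1]. x i) \<in> lcs_ideal N'"
    using prod_list_mem_lcs_ideal[of k n x] assms(1,2)
    unfolding assms(3)[symmetric] assms(4)[symmetric] assms(5)[symmetric] by blast
  then show ?thesis
    using lcs_ideal_subset_commutator_ideal[of N] unfolding x_def of_nat_eq_iff by blast
qed

end
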